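(* Let $G$ be a non-abelian finite group that is the central product of two of its subgroups $H$ and $K$. If $H$ and $K$ are both non-abelian then $$\operatorname{diam}(\Gamma(G)) \leq \min\{3, \operatorname{diam}(\Gamma(H)), \operatorname{diam}(\Gamma(K))\}.$$ Otherwise exactly one of $H$ and $K$, say $K$, is abelian, and then $$\operatorname{diam}(\Gamma(G)) = \operatorname{diam}(\Gamma(H)).$$
   Context: The commuting graph $\Gamma(G)$ of a group $G$ is the simple undirected graph whose vertices are the non-central elements of $G$ (for a subgroup $H$, $\Gamma(H)$ has as vertices the elements of $H$ not in the centre of $H$), with two distinct vertices $x,y$ adjacent if and only if $xy=yx$. The distance between two vertices is the length of a shortest path between them, and is $\infty$ if there is none; the diameter $\operatorname{diam}(\Gamma)$ is the maximum distance between two vertices of $\Gamma$ (so it is $\infty$ when $\Gamma$ is disconnected). $G$ is the central product of subgroups $H$ and $K$ if $G = HK$ and every element of $H$ commutes with every element of $K$. *)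

theory Defs
  imports "HOL-Algebra.Coset" "Graph_Theory.Graph_Theory"
begin

definition group_center :: "('a, 'b) monoid_scheme \<Rightarrow> 'a set" where
  "group_center G = {z \<in> carrier G. \<forall>x \<in> carrier G. z \<otimes>\<^bsub>G\<^esub> x = x \<otimes>\<^bsub>G\<^esub> z}"

text \<open>
  A simple undirected graph is represented as in \<^theory>\<open>Graph_Theory.Pair_Digraph\<close>: each edge
  is the two opposite arcs between its endpoints (\<^locale>\<open>pair_graph\<close>).
\<close>
definition commuting_graph :: "('a, 'b) monoid_scheme \<Rightarrow> 'a pair_pre_digraph" where
  "commuting_graph G = \<lparr>
     pverts = carrier G - group_center G,
     parcs = {(x, y). x \<in> carrier G - group_center G \<and> y \<in> carrier G - group_center G
                \<and> x \<noteq> y \<and> x \<otimes>\<^bsub>G\<^esub> y = y \<otimes>\<^bsub>G\<^esub> x}\<rparr>"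

lemma pair_graph_commuting_graph:
  assumes "finite (carrier G)"
  shows "pair_graph (commuting_graph G)"
proof
  have "parcs (commuting_graph G) \<subseteq> carrier G \<times> carrier G"
    by (auto simp: commuting_graph_def)
  then show "finite (parcs (commuting_graph G))"
    using assms finite_subset by blast
qed (use assms in \<open>auto simp: commuting_graph_def symmetric_def intro!: symI\<close>)

text \<open>
  With every arc of weight 1 the cost of a walk is its length. The infimum over all walks is
  \<open>\<infinity>\<close> if there is none, and otherwise the length of a path; see \<open>graph_dist_path\<close>.
\<close>
definition graph_dist :: "('a, 'b) pre_digraph \<Rightarrow> 'a \<Rightarrow> 'a \<Rightarrow> ereal" where
  "graph_dist \<Gamma> u v = wf_digraph.\<mu> \<Gamma> (\<lambda>_. 1) u v"

lemma (in fin_digraph) graph_dist_path: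
  assumes "u \<rightarrow>\<^sup>* v"
  shows "\<exists>p. apath u p v \<and> graph_dist G u v = ereal (real (length p))
           \<and> (\<forall>q. apath u q v \<longrightarrow> length p \<le> length q)"
proof -
  have cost: "awalk_cost (\<lambda>_. 1) q = real (length q)" for q :: "'b list"
    by (induction q) auto
  obtain p where p: "apath u p v" "\<mu> (\<lambda>_. 1) u v = awalk_cost (\<lambda>_. 1) p"
    using min_cost_awalk[OF assms, of "\<lambda>_. 1"] by auto
  have "length p \<le> length q" if "apath u q v" for q
    using min_cost_le_walk_cost[of u q v "\<lambda>_. 1"] that p(2)
    by (simp add: cost awalkI_apath)
  with p show ?thesis
    by (auto simp: graph_dist_def cost)
qed

text \<open>For a finite graph with at least one vertex the supremum is a maximum.\<close>
definition graph_diam :: "('a, 'b) pre_digraph \<Rightarrow> ereal" where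
  "graph_diam \<Gamma> = (SUP (u, v) \<in> verts \<Gamma> \<times> verts \<Gamma>. graph_dist \<Gamma> u v)"

definition central_product ::
    "('a, 'b) monoid_scheme \<Rightarrow> 'a set \<Rightarrow> 'a set \<Rightarrow> bool" where
  "central_product G H K \<longleftrightarrow>
     subgroup H G \<and> subgroup K G \<and> carrier G = H <#>\<^bsub>G\<^esub> K \<and>
     (\<forall>h \<in> H. \<forall>k \<in> K. h \<otimes>\<^bsub>G\<^esub> k = k \<otimes>\<^bsub>G\<^esub> h)"

abbreviation diam_commuting_graph :: "('a, 'b) monoid_scheme \<Rightarrow> ereal" where
  "diam_commuting_graph G \<equiv> graph_diam (with_proj (commuting_graph G))"

end

theory Submission
  imports Defs
begin

text \<open>
  Replacing adjacency by the reflexive relation "non-central and commuting", a distance is at most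
  \<open>n\<close> iff the two vertices are related by the \<open>n\<close>-th power of that relation. An element \<open>h k\<close> of a
  central product is central iff \<open>h\<close> and \<open>k\<close> are central in \<open>H\<close> and \<open>K\<close>, and it commutes with
  \<open>h\<close> and \<open>k\<close>. If both factors are non-abelian, \<open>h\<^sub>1 k\<^sub>1\<close> and \<open>h\<^sub>2 k\<^sub>2\<close> are joined by a path through \<open>h\<^sub>1\<close>
  and \<open>k\<^sub>2\<close>, or through \<open>k\<^sub>1\<close> and \<open>h\<^sub>2\<close>, or through a single element of one factor. As a
  non-abelian group has a commuting graph of diameter at least 2, only the case of
  diameter 2 remains for the comparison with \<open>H\<close>. If \<open>K\<close> is abelian, it is central in \<open>G\<close>, and
  \<open>h k \<mapsto> h\<close> preserves and reflects the commuting relation.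
\<close>

section \<open>Distances as powers of the reflexive commuting relation\<close>

definition commuting_rel :: "('a, 'b) monoid_scheme \<Rightarrow> ('a \<times> 'a) set" where
  "commuting_rel G = {(x, y). x \<in> carrier G - group_center G \<and> y \<in> carrier G - group_center G
                        \<and> x \<otimes>\<^bsub>G\<^esub> y = y \<otimes>\<^bsub>G\<^esub> x}"

text \<open>Loops at the end point \<open>v\<close> pad the path, which turns "at most
  \<open>n\<close> steps" into "exactly \<open>n\<close> steps".\<close>

lemma relpow_mono_refl_on:
  assumes "\<And>x. x \<in> A \<Longrightarrow> (x, x) \<in> R" and "(u, v) \<in> R ^^ m" and "v \<in> A" and "m \<le> n"
  shows "(u, v) \<in> R ^^ n"
proof -
  have "(v, v) \<in> R ^^ k" for k
    using assms(1,3) by (induction k) auto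
  then have "(u, v) \<in> R ^^ m O R ^^ (n - m)"
    using assms(2) by blast
  then show ?thesis
    using assms(4) by (simp flip: relpow_add)
qed

lemma (in wf_digraph) graph_dist_le_iff:
  "graph_dist G u v \<le> ereal r \<longleftrightarrow> (\<exists>p. awalk u p v \<and> real (length p) \<le> r)"
proof -
  have cost: "awalk_cost (\<lambda>_. 1) q = real (length q)" for q :: "'b list"
    by (induction q) auto
  have dist: "graph_dist G u v = (INF p\<in>{p. awalk u p v}. ereal (real (length p)))"
    unfolding graph_dist_def \<mu>_def by (simp add: cost)
  show ?thesis
  proof
    assume le: "graph_dist G u v \<le> ereal r"
    \<comment> \<open>A strict bound is attained by some walk, whereas a weak bound on an infimum
      need not be. Nothing is lost, since lengths are integers.\<close>
    also have "ereal r < ereal (real_of_int \<lfloor>r\<rfloor> + 1)"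
      by simp
    finally obtain p where p: "awalk u p v" "real (length p) < real_of_int \<lfloor>r\<rfloor> + 1"
      unfolding dist INF_less_iff by auto
    then have "int (length p) \<le> \<lfloor>r\<rfloor>"
      by linarith
    then show "\<exists>p. awalk u p v \<and> real (length p) \<le> r"
      using p(1) by (metis le_floor_iff of_int_of_nat_eq)
  next
    assume "\<exists>p. awalk u p v \<and> real (length p) \<le> r"
    then show "graph_dist G u v \<le> ereal r"
      unfolding dist by (auto intro: INF_lower2)
  qed
qed

lemma wf_digraph_commuting_graph: "wf_digraph (with_proj (commuting_graph G))"
  by unfold_locales (auto simp: commuting_graph_def)

lemma pverts_commuting_graph:
  "pverts (commuting_graph G) = carrier G - group_center G"
  by (simp add: commuting_graph_def)

lemma parcs_commuting_graph:
  "parcs (commuting_graph G) = {e \<in> commuting_rel G. fst e \<noteq> snd e}"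
  by (auto simp: commuting_graph_def commuting_rel_def)

lemma commuting_rel_refl: "x \<in> carrier G - group_center G \<Longrightarrow> (x, x) \<in> commuting_rel G"
  by (auto simp: commuting_rel_def)

lemmas relpow_commuting_rel_mono = relpow_mono_refl_on[OF commuting_rel_refl]

lemma awalk_commuting_graph_imp_relpow:
  assumes "pre_digraph.awalk (with_proj (commuting_graph G)) u p v"
  shows "(u, v) \<in> commuting_rel G ^^ length p"
proof -
  interpret wf_digraph "with_proj (commuting_graph G)"
    by (rule wf_digraph_commuting_graph)
  show ?thesis
    using assms
  proof (induction p arbitrary: u)
    case Nil
    then show ?case by (simp add: awalk_Nil_iff)
  next
    case (Cons e p)
    then have "(u, snd e) \<in> commuting_rel G" "(snd e, v) \<in> commuting_rel G ^^ length p"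
      by (auto simp: awalk_Cons_iff parcs_commuting_graph)
    then show ?case by (metis length_Cons relpow_Suc_I2)
  qed
qed

text \<open>Loop steps are not arcs and are dropped, so the walk may be shorter than
  \<open>n\<close>. The assumption on \<open>v\<close> serves \<open>n = 0\<close>: the zeroth power
  is the identity on the whole type, but an empty walk must sit at a vertex.\<close>

lemma relpow_imp_awalk_commuting_graph:
  assumes "(u, v) \<in> commuting_rel G ^^ n" and "v \<in> carrier G - group_center G"
  shows "\<exists>p. pre_digraph.awalk (with_proj (commuting_graph G)) u p v \<and> length p \<le> n"
proof -
  interpret wf_digraph "with_proj (commuting_graph G)"
    by (rule wf_digraph_commuting_graph)
  show ?thesis
    using assms(1)
  proof (induction n arbitrary: u)
    case 0
    then have "awalk u [] v"
      using assms(2) by (simp add: awalk_Nil_iff pverts_commuting_graph)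
    then show ?case by force
  next
    case (Suc n)
    then obtain w where w: "(u, w) \<in> commuting_rel G" "(w, v) \<in> commuting_rel G ^^ n"
      by (meson relpow_Suc_E2)
    obtain p where p: "awalk w p v" "length p \<le> n"
      using Suc.IH[OF w(2)] by blast
    show ?case
    proof (cases "u = w")
      case True
      then show ?thesis using p le_SucI by blast
    next
      case False
      then have "awalk u ((u, w) # p) v"
        using w(1) p(1) by (simp add: awalk_Cons_iff parcs_commuting_graph)
      then show ?thesis using p(2) by force
    qed
  qed
qed

text \<open>The bound is real because a finite diameter will be given only as some
  \<open>ereal r\<close>, with \<open>r\<close> not known to be an integer.\<close>

lemma graph_dist_commuting_graph_le_iff:
  assumes "v \<in> carrier G - group_center G" and "0 \<le> r"
  shows "graph_dist (with_proj (commuting_graph G)) u v \<le> ereal r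
           \<longleftrightarrow> (u, v) \<in> commuting_rel G ^^ nat \<lfloor>r\<rfloor>"
proof -
  interpret wf_digraph "with_proj (commuting_graph G)"
    by (rule wf_digraph_commuting_graph)
  have *: "real m \<le> r \<longleftrightarrow> m \<le> nat \<lfloor>r\<rfloor>" for m
    using assms(2) by (simp add: le_nat_floor le_floor_iff nat_le_iff le_nat_iff)
  show ?thesis
    unfolding graph_dist_le_iff *
    using relpow_imp_awalk_commuting_graph[OF _ assms(1)] awalk_commuting_graph_imp_relpow
      relpow_commuting_rel_mono[OF _ _ assms(1)] by metis
qed

section \<open>Comparing diameters through natural bounds\<close>

definition commuting_diam_le :: "('a, 'b) monoid_scheme \<Rightarrow> nat \<Rightarrow> bool" where
  "commuting_diam_le G n \<longleftrightarrow>
     (\<forall>u \<in> carrier G - group_center G. \<forall>v \<in> carrier G - group_center G.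
        (u, v) \<in> commuting_rel G ^^ n)"

lemma commuting_diam_le_mono: "commuting_diam_le G m \<Longrightarrow> m \<le> n \<Longrightarrow> commuting_diam_le G n"
  unfolding commuting_diam_le_def by (meson relpow_commuting_rel_mono)

lemma diam_commuting_graph_le_iff:
  "0 \<le> r \<Longrightarrow> diam_commuting_graph G \<le> ereal r \<longleftrightarrow> commuting_diam_le G (nat \<lfloor>r\<rfloor>)"
  unfolding graph_diam_def commuting_diam_le_def
  by (auto simp: SUP_le_iff graph_dist_commuting_graph_le_iff pverts_commuting_graph)

text \<open>The vertex is needed because the supremum over an empty vertex set is \<open>-\<infinity>\<close>.\<close>
lemma diam_commuting_graph_le_diam:
  assumes "x \<in> carrier G' - group_center G'"
    and "\<And>n. commuting_diam_le G' n \<Longrightarrow> commuting_diam_le G n"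
  shows "diam_commuting_graph G \<le> diam_commuting_graph G'"
proof -
  interpret wf_digraph "with_proj (commuting_graph G')"
    by (rule wf_digraph_commuting_graph)
  have "0 \<le> graph_dist (with_proj (commuting_graph G')) x x"
    unfolding graph_dist_def \<mu>_def by (intro INF_greatest) (simp add: pos_cost_pos_awalk_cost)
  also have "\<dots> \<le> diam_commuting_graph G'"
    unfolding graph_diam_def using assms(1) by (auto simp: commuting_graph_def intro!: SUP_upper2)
  finally have nonneg: "0 \<le> diam_commuting_graph G'" .
  then show ?thesis
  proof (cases "diam_commuting_graph G'")
    case (real r)
    with nonneg have "0 \<le> r" by simp
    then have "diam_commuting_graph G \<le> ereal r"
      using assms(2) real by (metis diam_commuting_graph_le_iff order_refl)
    then show ?thesis by (simp add: real)
  qed auto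
qed

section \<open>Commuting graphs of non-abelian groups\<close>

context group
begin

lemma ex_non_central:
  assumes "\<not> comm_group G"
  shows "\<exists>x. x \<in> carrier G - group_center G"
  using assms group_comm_groupI by (fastforce simp: group_center_def)

text \<open>With diameter at most 1 any two non-central elements would commute, and central ones
  commute with everything, so the group would be abelian.\<close>

lemma commuting_diam_le_imp_ge_2:
  assumes "\<not> comm_group G" and "commuting_diam_le G n"
  shows "2 \<le> n"
proof (rule ccontr)
  assume "\<not> 2 \<le> n"
  then have "commuting_diam_le G 1"
    using assms(2) commuting_diam_le_mono by (metis Suc_1 less_Suc_eq_le not_le)
  then have rel: "(x, y) \<in> commuting_rel G"
    if "x \<in> carrier G - group_center G" "y \<in> carrier G - group_center G" for x y
    using that by (simp add: commuting_diam_le_def)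
  have "x \<otimes> y = y \<otimes> x" if "x \<in> carrier G" "y \<in> carrier G" for x y
  proof (cases "x \<in> group_center G \<or> y \<in> group_center G")
    case True
    then show ?thesis
    proof
      assume "x \<in> group_center G"
      then show ?thesis
        using that(2) by (simp add: group_center_def)
    next
      assume "y \<in> group_center G"
      then have "y \<otimes> x = x \<otimes> y"
        using that(1) by (simp add: group_center_def)
      then show ?thesis by (rule sym)
    qed
  next
    case False
    then have "(x, y) \<in> commuting_rel G"
      using that rel by simp
    then show ?thesis
      by (simp add: commuting_rel_def)
  qed
  then show False
    using assms(1) group_comm_groupI by blast
qed

end

section \<open>Multiplication and centre of a central product\<close>

locale central_product_group = group G for G (structure) +
  fixes H K
  assumes central_product: "central_product G H K"
begin

abbreviation "GH \<equiv> G\<lparr>carrier := H\<rparr>"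
abbreviation "GK \<equiv> G\<lparr>carrier := K\<rparr>"

lemma subgroup_H: "subgroup H G" and subgroup_K: "subgroup K G"
  and factors_commute: "h \<in> H \<Longrightarrow> k \<in> K \<Longrightarrow> h \<otimes> k = k \<otimes> h"
  using central_product by (auto simp: central_product_def)

lemma H_carrier [simp, intro]: "h \<in> H \<Longrightarrow> h \<in> carrier G"
  and K_carrier [simp, intro]: "k \<in> K \<Longrightarrow> k \<in> carrier G"
  using subgroup_H subgroup_K subgroup.mem_carrier by metis+

lemma group_GH: "group GH" and group_GK: "group GK"
  using subgroup_H subgroup_K subgroup_imp_group by blast+

lemma H_closed [simp]: "a \<in> H \<Longrightarrow> b \<in> H \<Longrightarrow> a \<otimes> b \<in> H" "\<one> \<in> H"
  and K_closed [simp]: "c \<in> K \<Longrightarrow> d \<in> K \<Longrightarrow> c \<otimes> d \<in> K" "\<one> \<in> K"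
  using subgroup_H subgroup_K by (auto intro: subgroup.m_closed subgroup.one_closed)

lemma carrierE:
  assumes "x \<in> carrier G"
  obtains h k where "h \<in> H" "k \<in> K" "x = h \<otimes> k"
  using assms central_product by (auto simp: central_product_def set_mult_def)

text \<open>The inner factors \<open>c\<close> and \<open>b\<close> commute, so (h, k) \<mapsto>
  \<open>h \<otimes> k\<close> is a homomorphism from the direct product. Questions of commuting
  thus reduce to the factors.\<close>

lemma mult_mult_factors:
  assumes "a \<in> H" "b \<in> H" "c \<in> K" "d \<in> K"
  shows "(a \<otimes> c) \<otimes> (b \<otimes> d) = (a \<otimes> b) \<otimes> (c \<otimes> d)"
proof -
  have "(a \<otimes> c) \<otimes> (b \<otimes> d) = a \<otimes> (c \<otimes> b) \<otimes> d"
    using assms by (simp add: m_assoc)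
  also have "\<dots> = a \<otimes> (b \<otimes> c) \<otimes> d"
    using factors_commute[of b c] assms by simp
  finally show ?thesis
    using assms by (simp add: m_assoc)
qed

text \<open>The two products are \<open>(a \<otimes> b) \<otimes> c\<close> and
  \<open>(b \<otimes> a) \<otimes> c\<close>, and \<open>c\<close> cancels.\<close>

lemma commute_H_iff:
  assumes "a \<in> H" "b \<in> H" "c \<in> K"
  shows "(a \<otimes> c) \<otimes> b = b \<otimes> (a \<otimes> c) \<longleftrightarrow> a \<otimes> b = b \<otimes> a"
  using mult_mult_factors[of a b c \<one>] mult_mult_factors[of b a \<one> c] assms by simp

lemma commute_K_iff:
  assumes "a \<in> H" "c \<in> K" "d \<in> K"
  shows "(a \<otimes> c) \<otimes> d = d \<otimes> (a \<otimes> c) \<longleftrightarrow> c \<otimes> d = d \<otimes> c"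
  using mult_mult_factors[of a \<one> c d] mult_mult_factors[of \<one> a d c] assms by simp

text \<open>Testing a central \<open>h \<otimes> k\<close> against \<open>H\<close> and
  \<open>K\<close> separately gives one direction; componentwise multiplication gives the
  other.\<close>

lemma mult_mem_center_iff:
  assumes "h \<in> H" "k \<in> K"
  shows "h \<otimes> k \<in> group_center G \<longleftrightarrow> h \<in> group_center GH \<and> k \<in> group_center GK"
proof
  assume "h \<otimes> k \<in> group_center G"
  then show "h \<in> group_center GH \<and> k \<in> group_center GK"
    using assms by (auto simp: group_center_def dest: commute_H_iff[THEN iffD1] commute_K_iff[THEN iffD1])
next
  assume *: "h \<in> group_center GH \<and> k \<in> group_center GK"
  have "(h \<otimes> k) \<otimes> x = x \<otimes> (h \<otimes> k)" if "x \<in> carrier G" for x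
  proof -
    obtain a c where "a \<in> H" "c \<in> K" "x = a \<otimes> c"
      using \<open>x \<in> carrier G\<close> by (rule carrierE)
    moreover from this have "h \<otimes> a = a \<otimes> h" "k \<otimes> c = c \<otimes> k"
      using * by (auto simp: group_center_def)
    ultimately show ?thesis
      using assms mult_mult_factors[of h a k c] mult_mult_factors[of a h c k] by simp
  qed
  then show "h \<otimes> k \<in> group_center G"
    using assms by (auto simp: group_center_def)
qed

lemma one_mem_center: "\<one> \<in> group_center GH" "\<one> \<in> group_center GK"
  by (auto simp: group_center_def)

text \<open>Hence vertices of the commuting graph of \<open>H\<close> are vertices of that of
  \<open>G\<close>.\<close>

lemma H_mem_center_iff: "h \<in> H \<Longrightarrow> h \<in> group_center G \<longleftrightarrow> h \<in> group_center GH"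
  using mult_mem_center_iff[of h \<one>] by (simp add: one_mem_center)

lemma K_mem_center_iff: "k \<in> K \<Longrightarrow> k \<in> group_center G \<longleftrightarrow> k \<in> group_center GK"
  using mult_mem_center_iff[of \<one> k] by (simp add: one_mem_center)

text \<open>Interpreting the locale with the factors exchanged yields the mirror image of every
  result about \<open>H\<close>.\<close>

lemma central_product_group_commute: "central_product_group G K H"
proof unfold_locales
  have "H <#> K = K <#> H"
    by (auto simp: set_mult_def) (metis factors_commute)+
  then show "central_product G K H"
    using central_product by (auto simp: central_product_def)
qed

section \<open>Upper bounds from non-abelian factors\<close>

lemma commuting_diam_le_2:
  assumes H: "\<not> comm_group GH" and diam: "commuting_diam_le GH 2"
  shows "commuting_diam_le G 2"
proof -
  have "\<exists>z. (x, z) \<in> commuting_rel G \<and> (z, y) \<in> commuting_rel G"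
    if x: "x \<in> carrier G - group_center G" and y: "y \<in> carrier G - group_center G" for x y
  proof -
    obtain h k where x_eq: "h \<in> H" "k \<in> K" "x = h \<otimes> k"
      using x carrierE by auto
    obtain h' k' where y_eq: "h' \<in> H" "k' \<in> K" "y = h' \<otimes> k'"
      using y carrierE by auto
    \<comment> \<open>Such a \<open>z\<close> also commutes with \<open>k\<close> and
      \<open>k'\<close>, so it is a middle vertex between \<open>x\<close> and \<open>y\<close>. If
      \<open>h\<close> and \<open>h'\<close> are both central in \<open>H\<close>, any non-central
      element of \<open>H\<close> serves; if just one is, the other serves; if neither is, the
      diameter of \<open>H\<close> supplies \<open>z\<close>.\<close>
    have "\<exists>z. z \<in> H \<and> z \<notin> group_center GH \<and> h \<otimes> z = z \<otimes> h \<and> h' \<otimes> z = z \<otimes> h'"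
    proof (cases "h \<in> group_center GH")
      case hc: True
      show ?thesis
      proof (cases "h' \<in> group_center GH")
        case True
        then show ?thesis
          using group.ex_non_central[OF group_GH H] hc by (auto simp: group_center_def)
      next
        case False
        then show ?thesis
          using hc y_eq by (auto simp: group_center_def)
      qed
    next
      case hn: False
      show ?thesis
      proof (cases "h' \<in> group_center GH")
        case True
        then show ?thesis
          using hn x_eq by (auto simp: group_center_def)
      next
        case False
        then have "(h, h') \<in> commuting_rel GH O commuting_rel GH"
          using diam hn x_eq y_eq by (simp add: commuting_diam_le_def numeral_2_eq_2)
        then show ?thesis
          by (force simp: commuting_rel_def)
      qed
    qed
    then obtain z where "z \<in> H" "z \<notin> group_center GH" "h \<otimes> z = z \<otimes> h" "h' \<otimes> z = z \<otimes> h'"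
      by blast
    then show ?thesis
      using x y x_eq y_eq commute_H_iff[of h z k] commute_H_iff[of h' z k']
      by (auto simp: commuting_rel_def H_mem_center_iff intro!: exI[of _ z])
  qed
  then show ?thesis
    by (auto simp: commuting_diam_le_def numeral_2_eq_2)
qed

text \<open>The path is \<open>h \<otimes> k\<close>, \<open>h\<close>, \<open>k'\<close>,
  \<open>h' \<otimes> k'\<close>; its inner vertices come from different factors and so
  commute.\<close>

lemma relpow_3_commuting_rel:
  assumes "h \<in> H" "k \<in> K" "h' \<in> H" "k' \<in> K"
    and "h \<notin> group_center GH" and "k' \<notin> group_center GK"
  shows "(h \<otimes> k, h' \<otimes> k') \<in> commuting_rel G ^^ 3"
proof -
  have "(h \<otimes> k, h) \<in> commuting_rel G" "(h, k') \<in> commuting_rel G" "(k', h' \<otimes> k') \<in> commuting_rel G"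
    using assms commute_H_iff[of h h k] commute_K_iff[of h' k' k'] factors_commute
    by (auto simp: commuting_rel_def mult_mem_center_iff H_mem_center_iff K_mem_center_iff)
  then show ?thesis
    by (auto simp: numeral_3_eq_3)
qed

text \<open>As \<open>k\<close> and \<open>k'\<close> are central in \<open>K\<close>, every
  non-central \<open>z\<close> of \<open>K\<close> commutes with both products. A loop at
  \<open>z\<close> brings the number of steps to 3.\<close>

lemma relpow_3_commuting_rel_same_factor:
  assumes K: "\<not> comm_group GK"
    and "h \<in> H" "k \<in> K" "h' \<in> H" "k' \<in> K"
    and "h \<notin> group_center GH" "h' \<notin> group_center GH"
    and "k \<in> group_center GK" "k' \<in> group_center GK"
  shows "(h \<otimes> k, h' \<otimes> k') \<in> commuting_rel G ^^ 3"
proof -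
  obtain z where "z \<in> K" "z \<notin> group_center GK"
    using group.ex_non_central[OF group_GK K] by auto
  then have "(h \<otimes> k, z) \<in> commuting_rel G" "(z, h' \<otimes> k') \<in> commuting_rel G"
    "(z, z) \<in> commuting_rel G"
    using assms commute_K_iff[of h k z] commute_K_iff[of h' k' z]
    by (auto simp: commuting_rel_def mult_mem_center_iff K_mem_center_iff) (auto simp: group_center_def)
  then show ?thesis
    by (auto simp: numeral_3_eq_3)
qed

lemma commuting_diam_le_3:
  assumes H: "\<not> comm_group GH" and K: "\<not> comm_group GK"
  shows "commuting_diam_le G 3"
  unfolding commuting_diam_le_def
proof (intro ballI)
  fix x y assume x: "x \<in> carrier G - group_center G" and y: "y \<in> carrier G - group_center G"
  interpret KH: central_product_group G K H
    by (rule central_product_group_commute)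
  obtain h k where x_eq: "h \<in> H" "k \<in> K" "x = h \<otimes> k"
    using x carrierE by auto
  obtain h' k' where y_eq: "h' \<in> H" "k' \<in> K" "y = h' \<otimes> k'"
    using y carrierE by auto
  have swap: "h \<otimes> k = k \<otimes> h" "h' \<otimes> k' = k' \<otimes> h'"
    using x_eq y_eq factors_commute by auto
  \<comment> \<open>Each of \<open>x\<close> and \<open>y\<close> has a non-central component.
    Either such components can be chosen from different factors (the first two cases), or all of
    them lie in one factor (the last two).\<close>
  consider "h \<notin> group_center GH" "k' \<notin> group_center GK"
    | "k \<notin> group_center GK" "h' \<notin> group_center GH"
    | "h \<notin> group_center GH" "h' \<notin> group_center GH" "k \<in> group_center GK" "k' \<in> group_center GK"
    | "k \<notin> group_center GK" "k' \<notin> group_center GK" "h \<in> group_center GH" "h' \<in> group_center GH"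
    using x y x_eq y_eq mult_mem_center_iff by blast
  then show "(x, y) \<in> commuting_rel G ^^ 3"
  proof cases
    case 1
    then show ?thesis using relpow_3_commuting_rel x_eq y_eq by blast
  next
    case 2
    then show ?thesis using KH.relpow_3_commuting_rel x_eq y_eq swap by metis
  next
    case 3
    then show ?thesis using relpow_3_commuting_rel_same_factor K x_eq y_eq by blast
  next
    case 4
    then show ?thesis using KH.relpow_3_commuting_rel_same_factor H x_eq y_eq swap by metis
  qed
qed

lemma diam_le_diam_factor:
  assumes H: "\<not> comm_group GH" and K: "\<not> comm_group GK"
  shows "diam_commuting_graph G \<le> diam_commuting_graph GH"
proof -
  obtain x where "x \<in> carrier GH - group_center GH"
    using group.ex_non_central[OF group_GH H] by blast
  moreover have "commuting_diam_le G n" if "commuting_diam_le GH n" for n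
  \<comment> \<open>Bounds below 2 cannot hold for \<open>H\<close>, and from 3 on the general bound
    for \<open>G\<close> suffices; only here does the diameter of \<open>H\<close> itself
    enter.\<close>
  proof (cases "n = 2")
    case True
    then show ?thesis using that H commuting_diam_le_2 by simp
  next
    case False
    then have "3 \<le> n"
      using group.commuting_diam_le_imp_ge_2[OF group_GH H that] by simp
    then show ?thesis
      using commuting_diam_le_3[OF H K] commuting_diam_le_mono by blast
  qed
  ultimately show ?thesis
    by (rule diam_commuting_graph_le_diam)
qed

section \<open>One abelian factor: equality of diameters\<close>

lemma commuting_rel_mult_iff:
  assumes "comm_group GK" and "h \<in> H" "k \<in> K" "h' \<in> H" "k' \<in> K"
  shows "(h \<otimes> k, h' \<otimes> k') \<in> commuting_rel G \<longleftrightarrow> (h, h') \<in> commuting_rel GH"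
proof -
  have K_comm: "c \<otimes> d = d \<otimes> c" if "c \<in> K" "d \<in> K" for c d
    using comm_monoid.m_comm[OF comm_group.axioms(1)[OF assms(1)]] that by simp
  then have center: "group_center GK = K"
    by (auto simp: group_center_def)
  \<comment> \<open>The components in \<open>K\<close> of the two products agree and cancel.\<close>
  have "(h \<otimes> k) \<otimes> (h' \<otimes> k') = (h' \<otimes> k') \<otimes> (h \<otimes> k) \<longleftrightarrow> h \<otimes> h' = h' \<otimes> h"
    using assms K_comm[of k' k] mult_mult_factors[of h h' k k'] mult_mult_factors[of h' h k' k]
    by simp
  then show ?thesis
    using assms by (auto simp: commuting_rel_def mult_mem_center_iff center)
qed

text \<open>False for exponent \<open>0\<close>: \<open>h\<close> may differ from \<open>h'\<close> although \<open>h \<otimes> k = h' \<otimes> k'\<close>.\<close>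
lemma relpow_commuting_rel_mult_iff:
  assumes K: "comm_group GK" and "h \<in> H" "k \<in> K" "h' \<in> H" "k' \<in> K"
  shows "(h \<otimes> k, h' \<otimes> k') \<in> commuting_rel G ^^ Suc n \<longleftrightarrow> (h, h') \<in> commuting_rel GH ^^ Suc n"
  using assms(2,3)
proof (induction n arbitrary: h k)
  case 0
  then show ?case using commuting_rel_mult_iff assms by simp
next
  case (Suc n)
  show ?case
  proof
    assume "(h \<otimes> k, h' \<otimes> k') \<in> commuting_rel G ^^ Suc (Suc n)"
    then obtain x where x: "(h \<otimes> k, x) \<in> commuting_rel G" "(x, h' \<otimes> k') \<in> commuting_rel G ^^ Suc n"
      by (meson relpow_Suc_E2)
    then have "x \<in> carrier G"
      by (simp add: commuting_rel_def)
    then obtain a b where "a \<in> H" "b \<in> K" "x = a \<otimes> b"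
      by (rule carrierE)
    then have "(h, a) \<in> commuting_rel GH" "(a, h') \<in> commuting_rel GH ^^ Suc n"
      using x Suc commuting_rel_mult_iff[OF K] by blast+
    then show "(h, h') \<in> commuting_rel GH ^^ Suc (Suc n)"
      by (rule relpow_Suc_I2)
  next
    assume "(h, h') \<in> commuting_rel GH ^^ Suc (Suc n)"
    then obtain a where a: "(h, a) \<in> commuting_rel GH" "(a, h') \<in> commuting_rel GH ^^ Suc n"
      by (meson relpow_Suc_E2)
    then have "a \<in> H"
      by (simp add: commuting_rel_def)
    \<comment> \<open>The vertex \<open>a\<close> is lifted to itself, written as a product to match
      the induction hypothesis.\<close>
    then have "(h \<otimes> k, a \<otimes> \<one>) \<in> commuting_rel G" "(a \<otimes> \<one>, h' \<otimes> k') \<in> commuting_rel G ^^ Suc n"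
      using a Suc commuting_rel_mult_iff[OF K] K_closed(2) by blast+
    then show "(h \<otimes> k, h' \<otimes> k') \<in> commuting_rel G ^^ Suc (Suc n)"
      by (rule relpow_Suc_I2)
  qed
qed

text \<open>With \<open>K\<close> abelian, the vertices for \<open>G\<close> are exactly the
  products \<open>h \<otimes> k\<close> with \<open>h\<close> non-central in \<open>H\<close>, so
  the correspondence of paths reaches all pairs of vertices.\<close>

lemma commuting_diam_le_Suc_iff:
  assumes K: "comm_group GK"
  shows "commuting_diam_le G (Suc n) \<longleftrightarrow> commuting_diam_le GH (Suc n)"
proof -
  have center: "k \<in> group_center GK" if "k \<in> K" for k
    using comm_monoid.m_comm[OF comm_group.axioms(1)[OF K]] that by (simp add: group_center_def)
  show ?thesis
  proof
    assume G: "commuting_diam_le G (Suc n)"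
    show "commuting_diam_le GH (Suc n)"
      unfolding commuting_diam_le_def
    proof (intro ballI)
      fix h h' assume "h \<in> carrier GH - group_center GH" "h' \<in> carrier GH - group_center GH"
      moreover from this have "(h \<otimes> \<one>, h' \<otimes> \<one>) \<in> commuting_rel G ^^ Suc n"
        using G by (auto simp: commuting_diam_le_def H_mem_center_iff simp del: relpow.simps)
      ultimately show "(h, h') \<in> commuting_rel GH ^^ Suc n"
        using relpow_commuting_rel_mult_iff[OF K, of h \<one> h' \<one>] by simp
    qed
  next
    assume H: "commuting_diam_le GH (Suc n)"
    show "commuting_diam_le G (Suc n)"
      unfolding commuting_diam_le_def
    proof (intro ballI)
      fix x y assume x: "x \<in> carrier G - group_center G" and y: "y \<in> carrier G - group_center G"
      obtain h k where x_eq: "h \<in> H" "k \<in> K" "x = h \<otimes> k"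
        using x carrierE by auto
      obtain h' k' where y_eq: "h' \<in> H" "k' \<in> K" "y = h' \<otimes> k'"
        using y carrierE by auto
      have "h \<notin> group_center GH" "h' \<notin> group_center GH"
        using x y x_eq y_eq mult_mem_center_iff center by auto
      then have "(h, h') \<in> commuting_rel GH ^^ Suc n"
        using H x_eq y_eq by (simp add: commuting_diam_le_def del: relpow.simps)
      then show "(x, y) \<in> commuting_rel G ^^ Suc n"
        using relpow_commuting_rel_mult_iff[OF K] x_eq y_eq by blast
    qed
  qed
qed

text \<open>By contraposition, at most one factor of a non-abelian \<open>G\<close> is
  abelian.\<close>

lemma comm_group_if_comm_factors:
  assumes "comm_group GH" and "comm_group GK"
  shows "comm_group G"
proof (rule group_comm_groupI)
  fix x y assume "x \<in> carrier G" "y \<in> carrier G"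
  then obtain h k h' k' where *: "h \<in> H" "k \<in> K" "x = h \<otimes> k" "h' \<in> H" "k' \<in> K" "y = h' \<otimes> k'"
    by (elim carrierE)
  then have "h \<otimes> h' = h' \<otimes> h" "k \<otimes> k' = k' \<otimes> k"
    using comm_monoid.m_comm[OF comm_group.axioms(1)[OF assms(1)]]
      comm_monoid.m_comm[OF comm_group.axioms(1)[OF assms(2)]] by auto
  with * show "x \<otimes> y = y \<otimes> x"
    using mult_mult_factors[of h h' k k'] mult_mult_factors[of h' h k' k] by simp
qed

lemma diam_eq_diam_factor:
  assumes G: "\<not> comm_group G" and K: "comm_group GK"
  shows "diam_commuting_graph G = diam_commuting_graph GH"
proof (rule antisym)
  have H: "\<not> comm_group GH"
    using G K comm_group_if_comm_factors by blast
  obtain x y where "x \<in> carrier G - group_center G" "y \<in> carrier GH - group_center GH"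
    using ex_non_central[OF G] group.ex_non_central[OF group_GH H] by blast
  \<comment> \<open>For \<open>n = 0\<close> both sides are false, as neither group is abelian;
    every other \<open>n\<close> is a successor.\<close>
  moreover have "commuting_diam_le G n \<longleftrightarrow> commuting_diam_le GH n" for n
    using commuting_diam_le_imp_ge_2[OF G, of n] commuting_diam_le_Suc_iff[OF K, of "n - 1"]
      group.commuting_diam_le_imp_ge_2[OF group_GH H, of n] by (cases n) auto
  ultimately show "diam_commuting_graph G \<le> diam_commuting_graph GH"
    "diam_commuting_graph GH \<le> diam_commuting_graph G"
    using diam_commuting_graph_le_diam by metis+
qed

end

theorem theorem1p2:
  fixes G :: "('a, 'b) monoid_scheme" and H K :: "'a set"
  assumes "group G" and "finite (carrier G)" and "\<not> comm_group G"
    and "central_product G H K"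
  shows "(\<not> comm_group (G\<lparr>carrier := H\<rparr>) \<and> \<not> comm_group (G\<lparr>carrier := K\<rparr>) \<longrightarrow>
            diam_commuting_graph G \<le>
              Min {3, diam_commuting_graph (G\<lparr>carrier := H\<rparr>), diam_commuting_graph (G\<lparr>carrier := K\<rparr>)})
       \<and> (\<not> (\<not> comm_group (G\<lparr>carrier := H\<rparr>) \<and> \<not> comm_group (G\<lparr>carrier := K\<rparr>)) \<longrightarrow>
            (comm_group (G\<lparr>carrier := H\<rparr>) \<longleftrightarrow> \<not> comm_group (G\<lparr>carrier := K\<rparr>))
            \<and> (comm_group (G\<lparr>carrier := K\<rparr>) \<longrightarrow> diam_commuting_graph G = diam_commuting_graph (G\<lparr>carrier := H\<rparr>))
            \<and> (comm_group (G\<lparr>carrier := H\<rparr>) \<longrightarrow> diam_commuting_graph G = diam_commuting_graph (G\<lparr>carrier := K\<rparr>)))"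
proof -
  interpret group G by fact
  interpret HK: central_product_group G H K
    by unfold_locales fact
  interpret KH: central_product_group G K H
    by (rule HK.central_product_group_commute)
  have "diam_commuting_graph G \<le> 3"
    if "\<not> comm_group (G\<lparr>carrier := H\<rparr>)" "\<not> comm_group (G\<lparr>carrier := K\<rparr>)"
    using HK.commuting_diam_le_3[OF that] diam_commuting_graph_le_iff[of 3 G] by simp
  then show ?thesis
    \<comment> \<open>The \<open>KH\<close> instances give the bound by the diameter of
      \<open>K\<close> and the case of abelian \<open>H\<close>.\<close>
    using HK.diam_le_diam_factor KH.diam_le_diam_factor HK.comm_group_if_comm_factors
      HK.diam_eq_diam_factor KH.diam_eq_diam_factor assms(3) by auto
qed

end
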